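(* $\bigcup\text{CP-DBM}_+=\mathrm{FO}(\mathbb{Z},+,\leq)\uplus\bigcup\text{DBM}_{\mathbb{D}}$, where $\mathbb{D}=[0,1[$. That is, for every $n$, a set $R\subseteq\mathbb{R}^n$ is a finite union of $\text{CP-DBM}_+$ sets if and only if there exist $p\ge 1$, Presburger-definable sets $Z_1,\dots,Z_p\subseteq\mathbb{Z}^n$, and sets $D_1,\dots,D_p\subseteq\mathbb{D}^n$ in $\bigcup\text{DBM}_{\mathbb{D}}$ such that $R=\bigcup_{i=1}^p(Z_i+D_i)$.
   Context: $\mathbb{D}=[0,1[=\{x\in\mathbb{R}\mid 0\le x<1\}$. For $A,B\subseteq\mathbb{R}^n$, $A+B=\{a+b\mid a\in A,\ b\in B\}$. DBM: a Difference Bound Matrix (in dimension $n$) is a pair $(\mathbf{c},\mathbf{\prec})$ with $\mathbf{c}=(c_{i,j})_{0\le i,j\le n}$, $c_{i,j}\in\mathbb{Z}\cup\{+\infty\}$, and $\mathbf{\prec}=(\prec_{i,j})_{0\le i,j\le n}$, $\prec_{i,j}\in\{\le,<\}$. It represents the DBM set $$R_{\mathbf{c},\mathbf{\prec}}=\Big\{\mathbf{r}\in\mathbb{R}^n \;\Big|\; \bigwedge_{0\le i,j\le n} r_i-r_j\prec_{i,j}c_{i,j}\Big\},$$ where $\mathbf{r}=(r_1,\dots,r_n)$ and by convention $r_0=0$; the entry $c_{i,j}=+\infty$ means that there is no constraint on $r_i-r_j$. $\bigcup\text{DBM}_{\mathbb{D}}$ is the class of finite unions of DBM sets that are included in $\mathbb{D}^n$.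 $\mathrm{FO}(\mathbb{Z},+,\leq)$ is Presburger logic over the integers; it is identified with the class of sets $Z\subseteq\mathbb{Z}^n$ it defines. $\text{CP-DBM}_+$: a pair $(\phi,\mathbf{\prec})$ where $\mathbf{\prec}=(\prec_{i,j})_{0\le i,j\le n}$ with $\prec_{i,j}\in\{\le,<\}$, and $\phi(\mathbf{c})$ is a formula of Presburger logic $\mathrm{FO}(\mathbb{Z},+,\leq)$ (quantifiers allowed) whose free variables are the integer parameters $\mathbf{c}=(c_{i,j})_{0\le i,j\le n}$. It represents the set $$R_{\phi,\mathbf{\prec}}=\bigcup_{\mathbf{c}\models\phi}R_{\mathbf{c},\mathbf{\prec}}\subseteq\mathbb{R}^n .$$ $\bigcup\text{CP-DBM}_+$ is the class of finite unions of such sets $R_{\phi,\mathbf{\prec}}$ (in the same dimension $n$). For classes $\mathfrak{Z}$ of subsets of the $\mathbb{Z}^n$ and $\mathfrak{D}$ of subsets of the $\mathbb{D}^n$, $\mathfrak{Z}\uplus\mathfrak{D}$ is the class of all sets $R\subseteq\mathbb{R}^n$ of the form $R=\bigcup_{i=1}^p(Z_i+D_i)$ with $p\ge 1$, $Z_i\in\mathfrak{Z}$, $Z_i\subseteq\mathbb{Z}^n$, $D_i\in\mathfrak{D}$, $D_i\subseteq\mathbb{D}^n$. *)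

theory Defs
  imports Complex_Main "HOL-Library.Set_Algebras" "HOL-Library.Function_Algebras"
begin

text \<open>
  A vector \<open>(r\<^sub>1, \<dots>, r\<^sub>n)\<close> of dimension \<open>n\<close> is a function on \<^typ>\<open>nat\<close> vanishing
  outside \<open>{1..n}\<close>. In particular the convention \<open>r\<^sub>0 = 0\<close> is built in, and the sum of two sets
  of vectors is the elementwise sum from \<^theory>\<open>HOL-Library.Set_Algebras\<close> over the pointwise
  sum from \<^theory>\<open>HOL-Library.Function_Algebras\<close>.
\<close>

definition vecs :: "nat \<Rightarrow> 'a::zero set \<Rightarrow> (nat \<Rightarrow> 'a) set" where
  "vecs n S = {r. (\<forall>i\<in>{1..n}. r i \<in> S) \<and> (\<forall>i. i \<notin> {1..n} \<longrightarrow> r i = 0)}"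

definition unit_box :: "nat \<Rightarrow> (nat \<Rightarrow> real) set" where
  "unit_box n = vecs n {0..<1}"

definition finite_unions :: "'a set set \<Rightarrow> 'a set set" where
  "finite_unions C = {\<Union>F | F. finite F \<and> F \<subseteq> C}"

datatype cmp = Weak | Strict

fun cmp_rel :: "cmp \<Rightarrow> real \<Rightarrow> real \<Rightarrow> bool" where
  "cmp_rel Weak x y \<longleftrightarrow> x \<le> y"
| "cmp_rel Strict x y \<longleftrightarrow> x < y"

text \<open>A bound \<^term>\<open>None\<close> stands for \<open>+\<infinity>\<close>. Only entries with both indices in \<open>{0..n}\<close> matter.\<close>

definition dbm_set :: "nat \<Rightarrow> (nat \<Rightarrow> nat \<Rightarrow> int option) \<Rightarrow> (nat \<Rightarrow> nat \<Rightarrow> cmp) \<Rightarrow> (nat \<Rightarrow> real) set" where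
  "dbm_set n c prec = {r \<in> vecs n UNIV. \<forall>i\<in>{0..n}. \<forall>j\<in>{0..n}.
     (case c i j of None \<Rightarrow> True | Some k \<Rightarrow> cmp_rel (prec i j) (r i - r j) (of_int k))}"

definition DBM :: "nat \<Rightarrow> (nat \<Rightarrow> real) set set" where
  "DBM n = {dbm_set n c prec | c prec. True}"

definition Union_DBM_unit :: "nat \<Rightarrow> (nat \<Rightarrow> real) set set" where
  "Union_DBM_unit n = {D \<in> finite_unions (DBM n). D \<subseteq> unit_box n}"

text \<open>
  First-order formulas over the signature \<open>(+, \<le>)\<close> with equality. The type \<open>'v\<close> of variable names
  is used both for free and for bound variables, so it has to be infinite for this to be
  full first-order logic; it is only used below with \<^typ>\<open>nat\<close> and \<^typ>\<open>nat \<times> nat\<close>.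
\<close>

datatype 'v pres_term =
    Var 'v
  | Plus "'v pres_term" "'v pres_term"

datatype 'v pres_form =
    Leq "'v pres_term" "'v pres_term"
  | Equal "'v pres_term" "'v pres_term"
  | Neg "'v pres_form"
  | Conj "'v pres_form" "'v pres_form"
  | Exi 'v "'v pres_form"

fun term_val :: "('v \<Rightarrow> int) \<Rightarrow> 'v pres_term \<Rightarrow> int" where
  "term_val v (Var x) = v x"
| "term_val v (Plus s t) = term_val v s + term_val v t"

fun sat :: "('v \<Rightarrow> int) \<Rightarrow> 'v pres_form \<Rightarrow> bool" where
  "sat v (Leq s t) \<longleftrightarrow> term_val v s \<le> term_val v t"
| "sat v (Equal s t) \<longleftrightarrow> term_val v s = term_val v t"
| "sat v (Neg \<phi>) \<longleftrightarrow> \<not> sat v \<phi>"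
| "sat v (Conj \<phi> \<psi>) \<longleftrightarrow> sat v \<phi> \<and> sat v \<psi>"
| "sat v (Exi x \<phi>) \<longleftrightarrow> (\<exists>k. sat (v(x := k)) \<phi>)"

fun term_vars :: "'v pres_term \<Rightarrow> 'v set" where
  "term_vars (Var x) = {x}"
| "term_vars (Plus s t) = term_vars s \<union> term_vars t"

fun free_vars :: "'v pres_form \<Rightarrow> 'v set" where
  "free_vars (Leq s t) = term_vars s \<union> term_vars t"
| "free_vars (Equal s t) = term_vars s \<union> term_vars t"
| "free_vars (Neg \<phi>) = free_vars \<phi>"
| "free_vars (Conj \<phi> \<psi>) = free_vars \<phi> \<union> free_vars \<psi>"
| "free_vars (Exi x \<phi>) = free_vars \<phi> - {x}"

definition FO_sets :: "nat \<Rightarrow> (nat \<Rightarrow> int) set set" where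
  "FO_sets n = {{z \<in> vecs n UNIV. sat z \<phi>} | \<phi>. free_vars \<phi> \<subseteq> {1..n}}"

text \<open>The parameter \<open>c\<^bsub>i,j\<^esub>\<close> is the variable named \<open>(i, j)\<close>.\<close>

definition cp_dbm_set :: "nat \<Rightarrow> (nat \<times> nat) pres_form \<Rightarrow> (nat \<Rightarrow> nat \<Rightarrow> cmp) \<Rightarrow> (nat \<Rightarrow> real) set" where
  "cp_dbm_set n \<phi> prec = (\<Union>c\<in>{c. sat c \<phi>}. dbm_set n (\<lambda>i j. Some (c (i, j))) prec)"

definition CP_DBM :: "nat \<Rightarrow> (nat \<Rightarrow> real) set set" where
  "CP_DBM n = {cp_dbm_set n \<phi> prec | \<phi> prec. free_vars \<phi> \<subseteq> {0..n} \<times> {0..n}}"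

definition Union_CP_DBM :: "nat \<Rightarrow> (nat \<Rightarrow> real) set set" where
  "Union_CP_DBM n = finite_unions (CP_DBM n)"

definition real_vec :: "(nat \<Rightarrow> int) \<Rightarrow> nat \<Rightarrow> real" where
  "real_vec z = (\<lambda>i. of_int (z i))"

definition compose_classes ::
  "nat \<Rightarrow> (nat \<Rightarrow> int) set set \<Rightarrow> (nat \<Rightarrow> real) set set \<Rightarrow> (nat \<Rightarrow> real) set set" where
  "compose_classes n ZZ DD = {R. \<exists>p\<ge>1. \<exists>Z D.
     (\<forall>i\<in>{1..p::nat}. Z i \<in> ZZ \<and> Z i \<subseteq> vecs n UNIV \<and> D i \<in> DD \<and> D i \<subseteq> unit_box n) \<and>
     R = (\<Union>i\<in>{1..p}. real_vec ` Z i + D i)}"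

end

theory Submission
  imports Defs "HOL-Library.FuncSet" "HOL-Library.Nat_Bijection"
begin

text \<open>
  Write a vector as \<open>z + u\<close> with \<open>z\<close> integral and \<open>u\<close> in the unit box. Translation by \<open>z\<close> turns
  the bounds \<open>c\<^bsub>i,j\<^esub>\<close> into \<open>c\<^bsub>i,j\<^esub> - z\<^sub>i + z\<^sub>j\<close>, and on the unit box, where all differences
  lie strictly between \<open>-1\<close> and \<open>1\<close>, a bound only matters through its sign. A CP-DBM is thus
  split according to the finitely many sign matrices \<open>d\<close>: the integral parts \<open>z\<close> which lead to \<open>d\<close>
  for some admissible \<open>c\<close> form a Presburger set, and the fractional parts form the DBM given
  by \<open>d\<close>. Conversely \<open>Z + D\<close>, for a DBM \<open>D\<close> with bounds \<open>k\<^bsub>i,j\<^esub>\<close>, is the CP-DBM whose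
  parameters are the \<open>k\<^bsub>i,j\<^esub> + z\<^sub>i - z\<^sub>j\<close> with \<open>z \<in> Z\<close>; infinite bounds may be replaced by \<open>1\<close>.
\<close>

section \<open>Presburger formulas\<close>

lemma finite_term_vars: "finite (term_vars t)"
  by (induction t) auto

lemma finite_free_vars: "finite (free_vars \<phi>)"
  by (induction \<phi>) (auto simp: finite_term_vars)

lemma term_val_cong: "(\<And>x. x \<in> term_vars t \<Longrightarrow> v x = w x) \<Longrightarrow> term_val v t = term_val w t"
  by (induction t) auto

lemma sat_cong: "(\<And>x. x \<in> free_vars \<phi> \<Longrightarrow> v x = w x) \<Longrightarrow> sat v \<phi> \<longleftrightarrow> sat w \<phi>"
proof (induction \<phi> arbitrary: v w)
  case (Leq s t)
  then show ?case using term_val_cong[of s v w] term_val_cong[of t v w] by simp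
next
  case (Equal s t)
  then show ?case using term_val_cong[of s v w] term_val_cong[of t v w] by simp
next
  case (Neg \<phi>)
  then show ?case by (metis free_vars.simps(3) sat.simps(3))
next
  case (Conj \<phi> \<psi>)
  then show ?case by (metis UnCI free_vars.simps(4) sat.simps(4))
next
  case (Exi x \<phi>)
  have "sat (v(x := k)) \<phi> \<longleftrightarrow> sat (w(x := k)) \<phi>" for k
    using Exi.prems by (intro Exi.IH) auto
  then show ?case by simp
qed

lemma term_val_map: "term_val v (map_pres_term g t) = term_val (v \<circ> g) t"
  by (induction t) auto

text \<open>Free and bound names are renamed alike. Injectivity rules out capture: an update at
  \<open>g x\<close> is seen through \<open>g\<close> as an update at \<open>x\<close>
  alone.\<close>

lemma sat_map: "inj g \<Longrightarrow> sat v (map_pres_form g \<phi>) \<longleftrightarrow> sat (v \<circ> g) \<phi>"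
proof (induction \<phi> arbitrary: v)
  case (Exi x \<phi>)
  have "v(g x := k) \<circ> g = (v \<circ> g)(x := k)" for k
    using Exi.prems by (auto simp: fun_eq_iff inj_eq)
  then have "sat (v(g x := k)) (map_pres_form g \<phi>) \<longleftrightarrow> sat ((v \<circ> g)(x := k)) \<phi>" for k
    using Exi.IH[OF Exi.prems, of "v(g x := k)"] by metis
  then show ?case unfolding pres_form.map sat.simps by blast
qed (auto simp: term_val_map)

text \<open>Working with predicates on valuations avoids writing formulas out. Free variables are
  left uncontrolled here; \<open>definable_projection\<close> confines them afterwards.\<close>

definition definable :: "(('v \<Rightarrow> int) \<Rightarrow> bool) \<Rightarrow> bool" where
  "definable P \<longleftrightarrow> (\<exists>\<phi>. \<forall>v. sat v \<phi> \<longleftrightarrow> P v)"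

lemma definable_sat: "inj g \<Longrightarrow> definable (\<lambda>v. sat (v \<circ> g) \<phi>)"
  unfolding definable_def using sat_map by blast

lemma definable_leq: "definable (\<lambda>v. term_val v s \<le> term_val v t)"
  unfolding definable_def by (rule exI[of _ "Leq s t"]) simp

lemma definable_eq: "definable (\<lambda>v. term_val v s = term_val v t)"
  unfolding definable_def by (rule exI[of _ "Equal s t"]) simp

lemma definable_not: "definable P \<Longrightarrow> definable (\<lambda>v. \<not> P v)"
  unfolding definable_def by (metis sat.simps(3))

lemma definable_conj: "definable P \<Longrightarrow> definable Q \<Longrightarrow> definable (\<lambda>v. P v \<and> Q v)"
  unfolding definable_def by (metis sat.simps(4))

lemma definable_ex: "definable P \<Longrightarrow> definable (\<lambda>v. \<exists>k. P (v(x := k)))"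
  unfolding definable_def by (metis sat.simps(5))

lemma definable_const: "definable (\<lambda>v. b)"
proof -
  have "definable (\<lambda>v. term_val v (Var x) = term_val v (Var x))" for x :: 'a
    by (rule definable_eq)
  then show ?thesis using definable_not[of "\<lambda>_. True"] by (cases b) auto
qed

lemma definable_ball:
  "finite A \<Longrightarrow> (\<And>a. a \<in> A \<Longrightarrow> definable (P a)) \<Longrightarrow> definable (\<lambda>v. \<forall>a\<in>A. P a v)"
  by (induction A rule: finite_induct) (auto intro: definable_const definable_conj)

text \<open>
  The signature has no constants, so an integer offset is reached by unit steps, each of which
  costs one bound variable.
\<close>

lemma definable_leq_offset:
  fixes s t :: "'v pres_term"
  assumes inf: "infinite (UNIV :: 'v set)"
  shows "definable (\<lambda>v. term_val v s \<le> term_val v t + k)"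
proof -
  have fresh: "\<exists>x. \<forall>v k. term_val (v(x := k)) s = term_val v s \<and> term_val (v(x := k)) t = term_val v t"
    for s t :: "'v pres_term"
  proof -
    obtain x where "x \<notin> term_vars s \<union> term_vars t"
      using ex_new_if_finite[OF inf] finite_term_vars by (metis finite_UnI)
    then show ?thesis by (intro exI[of _ x]) (auto intro!: term_val_cong)
  qed
  show ?thesis
  proof (induction k arbitrary: s rule: int_induct[where k = 0])
    case base
    then show ?case using definable_leq by simp
  next
    case (step1 k)
    obtain x where x: "\<And>v k. term_val (v(x := k)) s = term_val v s"
        "\<And>v k. term_val (v(x := k)) t = term_val v t"
      using fresh by blast
    \<comment> \<open>Over the integers, \<open>a \<le> b + (k + 1)\<close> says that no
      \<open>u\<close> lies strictly between \<open>b + k\<close> and \<open>a\<close>. The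
      induction hypothesis is applied to \<open>Var x\<close> in place of \<open>s\<close>.\<close>
    have "definable (\<lambda>v. \<not> (\<exists>u. (\<not> term_val (v(x := u)) s \<le> term_val (v(x := u)) (Var x)) \<and>
        \<not> term_val (v(x := u)) (Var x) \<le> term_val (v(x := u)) t + k))"
      by (intro definable_not definable_ex[where P = "\<lambda>v. (\<not> term_val v s \<le> term_val v (Var x)) \<and>
        \<not> term_val v (Var x) \<le> term_val v t + k"] definable_conj definable_leq step1)
    moreover have "(\<not> (\<exists>u. \<not> a \<le> u \<and> \<not> u \<le> b + k)) \<longleftrightarrow> a \<le> b + (k + 1)" for a b :: int
      by (auto dest: spec[of _ "a - 1"])
    ultimately show ?case by (simp add: x)
  next
    case (step2 k)
    obtain x where x: "\<And>v k. term_val (v(x := k)) s = term_val v s"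
        "\<And>v k. term_val (v(x := k)) t = term_val v t"
      using fresh by blast
    \<comment> \<open>Dually, \<open>a \<le> b + (k - 1)\<close> says that some \<open>u\<close>
      above \<open>a\<close> is still at most \<open>b + k\<close>; the least candidate is
      \<open>a + 1\<close>.\<close>
    have "definable (\<lambda>v. \<exists>u. (\<not> term_val (v(x := u)) (Var x) \<le> term_val (v(x := u)) s) \<and>
        term_val (v(x := u)) (Var x) \<le> term_val (v(x := u)) t + k)"
      by (intro definable_ex[where P = "\<lambda>v. (\<not> term_val v (Var x) \<le> term_val v s) \<and>
        term_val v (Var x) \<le> term_val v t + k"] definable_not definable_conj definable_leq step2)
    moreover have "(\<exists>u. \<not> u \<le> a \<and> u \<le> b + k) \<longleftrightarrow> a \<le> b + (k - 1)" for a b :: int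
      by (auto intro: exI[of _ "a + 1"])
    ultimately show ?case by (simp add: x)
  qed
qed

lemma definable_eq_offset:
  fixes s t :: "'v pres_term"
  assumes "infinite (UNIV :: 'v set)"
  shows "definable (\<lambda>v. term_val v s = term_val v t + k)"
proof -
  have "definable (\<lambda>v. term_val v s \<le> term_val v t + k \<and> term_val v t \<le> term_val v s + - k)"
    by (intro definable_conj definable_leq_offset assms)
  then show ?thesis by (rule back_subst[where P = definable]) auto
qed

text \<open>The sign of a difference records only how the two terms compare. A value of
  \<open>d\<close> that is not a sign yields the constant false.\<close>

lemma definable_sgn_diff:
  "definable (\<lambda>v. sgn (term_val v s - term_val v t) = d)"
proof -
  consider "d = 1" | "d = 0" | "d = -1" | "d \<notin> {1, 0, -1}" by blast
  then show ?thesis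
  proof cases
    case 1
    have "definable (\<lambda>v. \<not> term_val v s \<le> term_val v t)"
      by (intro definable_not definable_leq)
    then show ?thesis by (rule back_subst[where P = definable]) (auto simp: 1 sgn_if)
  next
    case 2
    show ?thesis
      by (rule back_subst[where P = definable, OF definable_eq[of s t]]) (auto simp: 2 sgn_if)
  next
    case 3
    have "definable (\<lambda>v. \<not> term_val v t \<le> term_val v s)"
      by (intro definable_not definable_leq)
    then show ?thesis by (rule back_subst[where P = definable]) (auto simp: 3 sgn_if)
  next
    case 4
    show ?thesis
      by (rule back_subst[where P = definable, OF definable_const[of False]])
        (use 4 in \<open>auto simp: sgn_if fun_eq_iff\<close>)
  qed
qed

text \<open>Only finitely many free variables lie outside \<open>V\<close>, and they are quantified
  away one by one. This eliminates the auxiliary variables in both directions of the proof.\<close>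

lemma definable_projection:
  assumes "definable P"
  obtains \<psi> where "free_vars \<psi> \<subseteq> V"
    and "\<And>v. sat v \<psi> \<longleftrightarrow> (\<exists>w. (\<forall>x\<in>V. w x = v x) \<and> P w)"
proof -
  obtain \<phi> where \<phi>: "\<And>v. sat v \<phi> \<longleftrightarrow> P v" using assms unfolding definable_def by blast
  have "\<exists>\<psi>. free_vars \<psi> = free_vars \<phi> - A \<and>
      (\<forall>v. sat v \<psi> \<longleftrightarrow> (\<exists>w. (\<forall>x. x \<notin> A \<longrightarrow> w x = v x) \<and> sat w \<phi>))" if "finite A" for A
    using that
  proof (induction A rule: finite_induct)
    case empty
    have "(\<exists>w. (\<forall>x. w x = v x) \<and> sat w \<phi>) \<longleftrightarrow> sat v \<phi>" for v
      by (metis ext)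
    then show ?case by auto
  next
    case (insert a A)
    then obtain \<psi> where \<psi>: "free_vars \<psi> = free_vars \<phi> - A"
      "\<And>v. sat v \<psi> \<longleftrightarrow> (\<exists>w. (\<forall>x. x \<notin> A \<longrightarrow> w x = v x) \<and> sat w \<phi>)" by blast
    have "(\<exists>k w. (\<forall>x. x \<notin> A \<longrightarrow> w x = (v(a := k)) x) \<and> sat w \<phi>) \<longleftrightarrow>
      (\<exists>w. (\<forall>x. x \<notin> insert a A \<longrightarrow> w x = v x) \<and> sat w \<phi>)" for v
    proof
      assume "\<exists>w. (\<forall>x. x \<notin> insert a A \<longrightarrow> w x = v x) \<and> sat w \<phi>"
      then obtain w where "\<forall>x. x \<notin> insert a A \<longrightarrow> w x = v x" "sat w \<phi>" by blast
      then show "\<exists>k w. (\<forall>x. x \<notin> A \<longrightarrow> w x = (v(a := k)) x) \<and> sat w \<phi>"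
        by (intro exI[of _ "w a"] exI[of _ w]) auto
    next
      assume "\<exists>k w. (\<forall>x. x \<notin> A \<longrightarrow> w x = (v(a := k)) x) \<and> sat w \<phi>"
      then obtain k w where "\<forall>x. x \<notin> A \<longrightarrow> w x = (v(a := k)) x" "sat w \<phi>" by blast
      then show "\<exists>w. (\<forall>x. x \<notin> insert a A \<longrightarrow> w x = v x) \<and> sat w \<phi>"
        by (intro exI[of _ w]) auto
    qed
    then show ?case using \<psi> by (intro exI[of _ "Exi a \<psi>"]) auto
  qed
  from this[of "free_vars \<phi> - V"] obtain \<psi>
    where \<psi>: "free_vars \<psi> = free_vars \<phi> - (free_vars \<phi> - V)"
      "\<And>v. sat v \<psi> \<longleftrightarrow> (\<exists>w. (\<forall>x. x \<notin> free_vars \<phi> - V \<longrightarrow> w x = v x) \<and> sat w \<phi>)"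
    using finite_free_vars by blast
  have "sat v \<psi> \<longleftrightarrow> (\<exists>w. (\<forall>x\<in>V. w x = v x) \<and> P w)" for v
  proof
    assume "\<exists>w. (\<forall>x\<in>V. w x = v x) \<and> P w"
    then obtain w where w: "\<forall>x\<in>V. w x = v x" "sat w \<phi>" using \<phi> by blast
    \<comment> \<open>The given \<open>w\<close> may differ from \<open>v\<close> at infinitely many
      names, but \<open>\<phi>\<close> sees only its free ones; elsewhere \<open>w\<close> is reset
      to \<open>v\<close>.\<close>
    let ?w = "\<lambda>x. if x \<in> free_vars \<phi> - V then w x else v x"
    have "sat ?w \<phi> \<longleftrightarrow> sat w \<phi>" using w(1) by (intro sat_cong) auto
    then show "sat v \<psi>" using w(2) \<psi>(2) by (auto intro!: exI[of _ ?w])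
  qed (use \<phi> \<psi>(2) in blast)
  then show ?thesis using that \<psi>(1) by blast
qed

section \<open>Finite unions\<close>

lemma finite_unionsI: "finite F \<Longrightarrow> F \<subseteq> C \<Longrightarrow> \<Union>F \<in> finite_unions C"
  unfolding finite_unions_def by blast

lemma finite_unions_UN: "finite I \<Longrightarrow> (\<And>i. i \<in> I \<Longrightarrow> f i \<in> C) \<Longrightarrow> (\<Union>i\<in>I. f i) \<in> finite_unions C"
  by (rule finite_unionsI) auto

lemma finite_unions_singleton: "A \<in> C \<Longrightarrow> A \<in> finite_unions C"
  using finite_unionsI[of "{A}" C] by simp

text \<open>A finite union of finite unions is a finite union. Both inclusions of the theorem
  thereby reduce to single generating sets.\<close>

lemma finite_unions_subset:
  assumes "A \<subseteq> finite_unions B"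
  shows "finite_unions A \<subseteq> finite_unions B"
proof
  fix R assume "R \<in> finite_unions A"
  then obtain F where F: "finite F" "F \<subseteq> A" "R = \<Union>F" unfolding finite_unions_def by blast
  then have "\<forall>X\<in>F. \<exists>G. finite G \<and> G \<subseteq> B \<and> X = \<Union>G"
    using assms unfolding finite_unions_def by blast
  then obtain G where G: "\<And>X. X \<in> F \<Longrightarrow> finite (G X) \<and> G X \<subseteq> B \<and> X = \<Union>(G X)" by metis
  then have "X = \<Union>(G X)" if "X \<in> F" for X using that by blast
  then have "(\<Union>X\<in>F. X) = (\<Union>X\<in>F. \<Union>(G X))" by (rule SUP_cong[OF refl])
  then have "R = \<Union>(\<Union>X\<in>F. G X)" using F(3) by auto
  moreover have "finite (\<Union>X\<in>F. G X)" "(\<Union>X\<in>F. G X) \<subseteq> B"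
    using F(1) G by (auto intro!: finite_UN_I simp: UN_subset_iff)
  ultimately show "R \<in> finite_unions B" using finite_unionsI by metis
qed

text \<open>These are the single summands, from which \<open>compose_classes\<close> is generated by
  finite unions.\<close>

definition sum_sets :: "nat \<Rightarrow> (nat \<Rightarrow> int) set set \<Rightarrow> (nat \<Rightarrow> real) set set \<Rightarrow> (nat \<Rightarrow> real) set set" where
  "sum_sets n ZZ DD =
    {real_vec ` Z + D | Z D. Z \<in> ZZ \<and> Z \<subseteq> vecs n UNIV \<and> D \<in> DD \<and> D \<subseteq> unit_box n}"

text \<open>The two sides differ only in that \<open>p \<ge> 1\<close> excludes the empty family,
  whose union is recovered from an empty summand.\<close>

lemma compose_classes_eq_finite_unions:
  assumes "{} \<in> sum_sets n ZZ DD"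
  shows "compose_classes n ZZ DD = finite_unions (sum_sets n ZZ DD)"
proof (intro equalityI subsetI)
  fix R assume "R \<in> compose_classes n ZZ DD"
  then obtain p Z D where ZD:
    "\<forall>i\<in>{1..p::nat}. Z i \<in> ZZ \<and> Z i \<subseteq> vecs n UNIV \<and> D i \<in> DD \<and> D i \<subseteq> unit_box n"
    and R: "R = (\<Union>i\<in>{1..p}. real_vec ` Z i + D i)"
    unfolding compose_classes_def by blast
  have "real_vec ` Z i + D i \<in> sum_sets n ZZ DD" if "i \<in> {1..p}" for i
    unfolding sum_sets_def using bspec[OF ZD that] by blast
  then show "R \<in> finite_unions (sum_sets n ZZ DD)"
    unfolding R by (intro finite_unions_UN finite_atLeastAtMost)
next
  fix R assume "R \<in> finite_unions (sum_sets n ZZ DD)"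
  then obtain F where F: "finite F" "F \<subseteq> sum_sets n ZZ DD" "R = \<Union>F"
    unfolding finite_unions_def by blast
  \<comment> \<open>The extra empty set leaves the union unchanged and ensures that at least one
    index exists.\<close>
  define G where "G = insert {} F"
  have "finite G" and G: "G \<subseteq> sum_sets n ZZ DD" "R = \<Union>G" "G \<noteq> {}"
    using F assms by (auto simp: G_def)
  obtain h where "bij_betw h {1..card G} G"
    using ex_bij_betw_nat_finite_1[OF \<open>finite G\<close>] by blast
  then have h: "h ` {1..card G} = G" by (simp add: bij_betw_def)
  have "\<forall>i\<in>{1..card G}. \<exists>Z D. h i = real_vec ` Z + D \<and>
      Z \<in> ZZ \<and> Z \<subseteq> vecs n UNIV \<and> D \<in> DD \<and> D \<subseteq> unit_box n"
  proof
    fix i assume "i \<in> {1..card G}"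
    then have "h i \<in> sum_sets n ZZ DD" using G(1) h by blast
    then show "\<exists>Z D. h i = real_vec ` Z + D \<and>
        Z \<in> ZZ \<and> Z \<subseteq> vecs n UNIV \<and> D \<in> DD \<and> D \<subseteq> unit_box n"
      unfolding sum_sets_def by blast
  qed
  then obtain Z D where ZD: "\<forall>i\<in>{1..card G}. h i = real_vec ` Z i + D i \<and>
      Z i \<in> ZZ \<and> Z i \<subseteq> vecs n UNIV \<and> D i \<in> DD \<and> D i \<subseteq> unit_box n"
    by metis
  have "card G \<ge> 1" using \<open>finite G\<close> \<open>G \<noteq> {}\<close> by (simp add: Suc_leI card_gt_0_iff)
  moreover have "(\<Union>i\<in>{1..card G}. h i) = (\<Union>i\<in>{1..card G}. real_vec ` Z i + D i)"
    using ZD by (intro SUP_cong) auto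
  then have "R = (\<Union>i\<in>{1..card G}. real_vec ` Z i + D i)"
    unfolding h G(2) .
  ultimately show "R \<in> compose_classes n ZZ DD"
    unfolding compose_classes_def using ZD by blast
qed

section \<open>Difference bound matrices\<close>

text \<open>Every coordinate lies in \<open>[0,1[\<close>, including those outside
  \<open>{1..n}\<close>, which are 0; so index 0 needs no special treatment.\<close>

lemma unit_box_diff:
  assumes "u \<in> unit_box n"
  shows "\<bar>u i - u j\<bar> < 1"
proof -
  have "0 \<le> u k \<and> u k < 1" for k
    using assms by (cases "k \<in> {1..n}") (auto simp: unit_box_def vecs_def)
  from this[of i] this[of j] show ?thesis by linarith
qed

text \<open>For \<open>x\<close> strictly between -1 and 1, a bound of at least 1 always holds and a
  bound of at most -1 always fails, whether strict or weak.\<close>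

lemma cmp_rel_cong_sgn:
  assumes "\<bar>x\<bar> < 1"
  shows "cmp_rel p x (of_int c) \<longleftrightarrow> cmp_rel p x (of_int (sgn c))"
proof -
  consider "c \<ge> 1" | "c = 0" | "c \<le> -1" by linarith
  then show ?thesis
  proof cases
    case 1
    then have "sgn c = 1" "(of_int c :: real) \<ge> 1" by (auto simp: sgn_if)
    then show ?thesis using assms by (cases p) auto
  next
    case 3
    then have "sgn c = -1" "(of_int c :: real) \<le> of_int (-1)"
      by (auto simp: sgn_if simp del: of_int_minus)
    then show ?thesis using assms by (cases p) auto
  qed simp
qed

lemma real_vec_add_in_vecs:
  assumes "z \<in> vecs n UNIV"
  shows "real_vec z + u \<in> vecs n UNIV \<longleftrightarrow> u \<in> vecs n UNIV"
  using assms by (auto simp: vecs_def real_vec_def)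

lemma real_vec_add_in_dbm_set:
  assumes "z \<in> vecs n UNIV"
  shows "real_vec z + u \<in> dbm_set n (\<lambda>i j. Some (c (i, j))) prec \<longleftrightarrow>
    u \<in> dbm_set n (\<lambda>i j. Some (c (i, j) - z i + z j)) prec"
proof -
  have "cmp_rel p ((real_vec z + u) i - (real_vec z + u) j) (of_int k) \<longleftrightarrow>
      cmp_rel p (u i - u j) (of_int (k - z i + z j))" for i j k p
    by (cases p) (auto simp: real_vec_def)
  then show ?thesis by (simp add: dbm_set_def real_vec_add_in_vecs[OF assms] del: plus_fun_apply)
qed

lemma dbm_set_cong_on_unit_box:
  assumes "u \<in> unit_box n"
    and "\<And>i j. i \<le> n \<Longrightarrow> j \<le> n \<Longrightarrow> sgn (c i j) = sgn (d i j)"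
  shows "u \<in> dbm_set n (\<lambda>i j. Some (c i j)) prec \<longleftrightarrow> u \<in> dbm_set n (\<lambda>i j. Some (d i j)) prec"
proof -
  have "cmp_rel p (u i - u j) (of_int (c i j)) \<longleftrightarrow> cmp_rel p (u i - u j) (of_int (d i j))"
    if "i \<le> n" "j \<le> n" for p i j
    using cmp_rel_cong_sgn[OF unit_box_diff[OF assms(1)]] assms(2)[OF that] by metis
  then show ?thesis by (auto simp: dbm_set_def)
qed

text \<open>The smaller of two upper bounds is the effective one; for equal constants the strict
  comparison wins.\<close>

lemma cmp_rel_conj:
  "\<exists>p c. \<forall>x. cmp_rel p x (real_of_int c) \<longleftrightarrow> cmp_rel p1 x (of_int c1) \<and> cmp_rel p2 x (of_int c2)"
proof -
  consider "c1 < c2" | "c2 < c1" | "c1 = c2" by linarith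
  then show ?thesis
  proof cases
    case 1
    then show ?thesis by (cases p1; cases p2) (intro exI[of _ p1] exI[of _ c1]; force)+
  next
    case 2
    then show ?thesis by (cases p1; cases p2) (intro exI[of _ p2] exI[of _ c2]; force)+
  next
    case 3
    then show ?thesis
      by (intro exI[of _ "if p1 = Strict then p1 else p2"] exI[of _ c1]; cases p1; cases p2) auto
  qed
qed

text \<open>The two constraints on each difference merge into one. This is needed to cut a DBM down
  to the unit box.\<close>

lemma DBM_Int:
  assumes "A \<in> DBM n" "B \<in> DBM n"
  shows "A \<inter> B \<in> DBM n"
proof -
  let ?sat = "\<lambda>c p x. case c of None \<Rightarrow> True | Some k \<Rightarrow> cmp_rel p x (real_of_int k)"
  obtain c1 p1 c2 p2 where AB: "A = dbm_set n c1 p1" "B = dbm_set n c2 p2"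
    using assms by (auto simp: DBM_def)
  have "\<exists>c p. \<forall>x. ?sat c p x \<longleftrightarrow> ?sat (c1 i j) (p1 i j) x \<and> ?sat (c2 i j) (p2 i j) x" for i j
  proof (cases "c1 i j")
    case None
    then show ?thesis by auto
  next
    case c1: (Some k1)
    show ?thesis
    proof (cases "c2 i j")
      case None
      then show ?thesis by auto
    next
      case (Some k2)
      obtain p c where "\<forall>x. cmp_rel p x (real_of_int c) \<longleftrightarrow>
          cmp_rel (p1 i j) x (of_int k1) \<and> cmp_rel (p2 i j) x (of_int k2)"
        using cmp_rel_conj by metis
      then show ?thesis using c1 Some by (intro exI[of _ "Some c"] exI[of _ p]) simp
    qed
  qed
  then obtain c p where
    "\<And>i j x. ?sat (c i j) (p i j) x \<longleftrightarrow> ?sat (c1 i j) (p1 i j) x \<and> ?sat (c2 i j) (p2 i j) x"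
    by metis
  then have "A \<inter> B = dbm_set n c p" by (auto simp: AB dbm_set_def)
  then show ?thesis by (auto simp: DBM_def)
qed

lemma unit_box_in_DBM: "unit_box n \<in> DBM n"
proof -
  \<comment> \<open>With \<open>u 0 = 0\<close>, column 0 expresses \<open>u i < 1\<close> and row 0
    expresses \<open>0 \<le> u j\<close>.\<close>
  let ?c = "\<lambda>i j. if j = 0 then (if i = 0 then None else Some 1) else if i = 0 then Some 0 else None"
  let ?p = "\<lambda>i j. if j = (0::nat) then Strict else Weak"
  have "u \<in> unit_box n \<longleftrightarrow> u \<in> dbm_set n ?c ?p" for u
  proof
    assume u: "u \<in> dbm_set n ?c ?p"
    have u0: "u 0 = 0" using u by (auto simp: dbm_set_def vecs_def)
    have "0 \<le> u i \<and> u i < 1" if "i \<in> {1..n}" for i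
    proof -
      have *: "case ?c k l of None \<Rightarrow> True | Some b \<Rightarrow> cmp_rel (?p k l) (u k - u l) (of_int b)"
        if "k \<in> {0..n}" "l \<in> {0..n}" for k l
        using u that unfolding dbm_set_def by blast
      from *[of i 0] *[of 0 i] show ?thesis using that u0 by simp
    qed
    then show "u \<in> unit_box n" using u by (auto simp: unit_box_def dbm_set_def vecs_def)
  qed (auto simp: unit_box_def dbm_set_def vecs_def)
  then show ?thesis unfolding DBM_def by blast
qed

text \<open>The parameters of a CP-DBM are integers, so infinite bounds have to go. In the unit box
  all differences are below 1, so the bound 1 is vacuous for either comparison.\<close>

lemma DBM_bounded_entries:
  assumes "A \<in> DBM n" "A \<subseteq> unit_box n"
  obtains k prec where "A = dbm_set n (\<lambda>i j. Some (k (i, j))) prec"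
proof -
  obtain c prec where A: "A = dbm_set n c prec" using assms(1) by (auto simp: DBM_def)
  define k where "k = (\<lambda>(i, j). case c i j of None \<Rightarrow> 1 | Some b \<Rightarrow> b)"
  have "A = dbm_set n (\<lambda>i j. Some (k (i, j))) prec"
  proof (intro equalityI subsetI)
    fix u assume u: "u \<in> A"
    have "cmp_rel p (u i - u j) 1" for p i j
      using unit_box_diff[of u n i j] u assms(2) by (cases p) auto
    then show "u \<in> dbm_set n (\<lambda>i j. Some (k (i, j))) prec"
      using u unfolding A dbm_set_def k_def by (fastforce split: option.splits)
  qed (auto simp: A dbm_set_def k_def split: option.splits)
  then show ?thesis using that by blast
qed

lemma vecs_decompose:
  assumes "r \<in> vecs n UNIV"
  obtains z u where "z \<in> vecs n UNIV" "u \<in> unit_box n" "r = real_vec z + u"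
proof
  show "(\<lambda>i. \<lfloor>r i\<rfloor>) \<in> vecs n UNIV" "(\<lambda>i. frac (r i)) \<in> unit_box n"
    using assms by (auto simp: vecs_def unit_box_def frac_lt_1)
  show "r = real_vec (\<lambda>i. \<lfloor>r i\<rfloor>) + (\<lambda>i. frac (r i))"
    by (auto simp: real_vec_def frac_def)
qed

section \<open>Integral and fractional parts\<close>

lemma empty_in_sum_sets: "{} \<in> sum_sets n (FO_sets n) (Union_DBM_unit n)"
proof -
  \<comment> \<open>The unsatisfiable formula is chosen closed, so that it is also admissible for
    \<open>n = 0\<close>.\<close>
  have "{} \<in> FO_sets n"
    unfolding FO_sets_def
    by (rule CollectI, rule exI[of _ "Exi 1 (Neg (Equal (Var 1) (Var 1)))"]) auto
  moreover have "{} \<in> Union_DBM_unit n"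
    using finite_unionsI[of "{}"] by (auto simp: Union_DBM_unit_def)
  moreover have "real_vec ` {} + {} = {}" by (simp add: set_plus_def)
  ultimately show ?thesis unfolding sum_sets_def by blast
qed

section \<open>From CP-DBMs to sums of integral and fractional parts\<close>

definition sign_cell :: "nat \<Rightarrow> (nat \<times> nat) pres_form \<Rightarrow> (nat \<times> nat \<Rightarrow> int) \<Rightarrow> (nat \<Rightarrow> int) set" where
  "sign_cell n \<phi> d = {z \<in> vecs n UNIV. \<exists>c. sat c \<phi> \<and>
     (\<forall>(i, j)\<in>{0..n} \<times> {0..n}. sgn (c (i, j) - z i + z j) = d (i, j))}"

text \<open>Parameters and coordinates of \<open>z\<close> are placed in one name space; projecting
  to the names \<open>{1..n}\<close> then quantifies the parameters away.\<close>

lemma sign_cell_in_FO_sets: "sign_cell n \<phi> d \<in> FO_sets n"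
proof -
  text \<open>The names \<open>0\<close> to \<open>n\<close> are kept for \<open>z\<close>, with \<open>z\<^sub>0 = 0\<close> imposed by an equation.\<close>
  define g where "g p = n + 1 + prod_encode p" for p
  have g: "inj g" by (auto simp: g_def inj_def prod_encode_eq)
  \<comment> \<open>Without constants, \<open>x = 0\<close> is written as \<open>x + x = x\<close>.
    Without subtraction, \<open>z\<^sub>j\<close> is added to \<open>c\<^sub>i\<^sub>j\<close> and
    the sum compared with \<open>z\<^sub>i\<close>.\<close>
  define P where "P w \<longleftrightarrow> sat (w \<circ> g) \<phi> \<and>
    term_val w (Plus (Var 0) (Var 0)) = term_val w (Var 0) \<and>
    (\<forall>p\<in>{0..n} \<times> {0..n}. sgn (term_val w (Plus (Var (g p)) (Var (snd p))) -
       term_val w (Var (fst p))) = d p)" for w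
  have P_iff: "P w \<longleftrightarrow> sat (w \<circ> g) \<phi> \<and> w 0 = 0 \<and>
      (\<forall>i\<le>n. \<forall>j\<le>n. sgn (w (g (i, j)) - w i + w j) = d (i, j))" for w
    unfolding P_def by (simp add: Ball_def algebra_simps imp_conjL)
  have "definable P"
    unfolding P_def
    by (intro definable_conj definable_sat g definable_eq definable_ball definable_sgn_diff) simp
  then obtain \<psi> where \<psi>: "free_vars \<psi> \<subseteq> {1..n}"
    "\<And>v. sat v \<psi> \<longleftrightarrow> (\<exists>w. (\<forall>x\<in>{1..n}. w x = v x) \<and> P w)"
    by (rule definable_projection[where V = "{1..n}"]) blast
  have "z \<in> sign_cell n \<phi> d \<longleftrightarrow> z \<in> vecs n UNIV \<and> sat z \<psi>" for z
  proof (cases "z \<in> vecs n UNIV")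
    case z: True
    have "(\<exists>c. sat c \<phi> \<and> (\<forall>(i, j)\<in>{0..n} \<times> {0..n}. sgn (c (i, j) - z i + z j) = d (i, j))) \<longleftrightarrow>
      (\<exists>w. (\<forall>x\<in>{1..n}. w x = z x) \<and> P w)"
    proof
      assume "\<exists>c. sat c \<phi> \<and> (\<forall>(i, j)\<in>{0..n} \<times> {0..n}. sgn (c (i, j) - z i + z j) = d (i, j))"
      then obtain c where c: "sat c \<phi>"
        "\<forall>(i, j)\<in>{0..n} \<times> {0..n}. sgn (c (i, j) - z i + z j) = d (i, j)" by blast
      \<comment> \<open>Since \<open>prod_encode\<close> is a bijection, each name above
        \<open>n\<close> encodes exactly one parameter, which \<open>inv g\<close> recovers.\<close>
      define w where "w x = (if x \<le> n then z x else c (inv g x))" for x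
      have wg: "w (g p) = c p" for p using g by (auto simp: w_def) (simp add: g_def)
      then have "w \<circ> g = c" by auto
      moreover have "z 0 = 0" using z by (simp add: vecs_def)
      ultimately have "P w" unfolding P_iff wg using c by (simp add: w_def)
      then show "\<exists>w. (\<forall>x\<in>{1..n}. w x = z x) \<and> P w" by (intro exI[of _ w]) (auto simp: w_def)
    next
      assume "\<exists>w. (\<forall>x\<in>{1..n}. w x = z x) \<and> P w"
      then obtain w where w: "\<forall>x\<in>{1..n}. w x = z x" "P w" by blast
      have "w i = z i" if "i \<le> n" for i
        using w that z by (cases "i = 0") (auto simp: P_iff vecs_def)
      then show "\<exists>c. sat c \<phi> \<and> (\<forall>(i, j)\<in>{0..n} \<times> {0..n}. sgn (c (i, j) - z i + z j) = d (i, j))"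
        using w(2) unfolding P_iff by (intro exI[of _ "w \<circ> g"]) auto
    qed
    then show ?thesis by (simp add: sign_cell_def \<psi>(2) z)
  qed (simp add: sign_cell_def)
  then have "sign_cell n \<phi> d = {z \<in> vecs n UNIV. sat z \<psi>}" by blast
  then show ?thesis using \<psi>(1) unfolding FO_sets_def by blast
qed

text \<open>The functions \<open>d\<close> are extensional, that is, fixed outside
  \<open>{0..n} \<times> {0..n}\<close>, which makes the union on the right finite.\<close>

lemma cp_dbm_set_eq_UN_sign_cells:
  "cp_dbm_set n \<phi> prec = (\<Union>d\<in>{0..n} \<times> {0..n} \<rightarrow>\<^sub>E {-1, 0, 1}.
     real_vec ` sign_cell n \<phi> d + (dbm_set n (\<lambda>i j. Some (d (i, j))) prec \<inter> unit_box n))"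
    (is "_ = (\<Union>d\<in>?S. ?T d)")
proof (intro equalityI subsetI)
  fix r assume "r \<in> cp_dbm_set n \<phi> prec"
  then obtain c where c: "sat c \<phi>" and r: "r \<in> dbm_set n (\<lambda>i j. Some (c (i, j))) prec"
    unfolding cp_dbm_set_def by blast
  have "r \<in> vecs n UNIV" using r by (simp add: dbm_set_def)
  then obtain z u where zu: "z \<in> vecs n UNIV" "u \<in> unit_box n" "r = real_vec z + u"
    by (rule vecs_decompose)
  define d where "d = restrict (\<lambda>(i, j). sgn (c (i, j) - z i + z j)) ({0..n} \<times> {0..n})"
  have d: "d (i, j) = sgn (c (i, j) - z i + z j)" if "i \<le> n" "j \<le> n" for i j
    using that by (simp add: d_def)
  have "sgn k \<in> {-1, 0, 1}" for k :: int by (simp add: sgn_if)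
  then have "d \<in> ?S" unfolding d_def by (auto simp only: restrict_PiE_iff split_beta)
  have "z \<in> sign_cell n \<phi> d" using zu(1) c by (auto simp: sign_cell_def d_def)
  moreover have "u \<in> dbm_set n (\<lambda>i j. Some (c (i, j) - z i + z j)) prec"
    using r real_vec_add_in_dbm_set[OF zu(1)] zu(3) by blast
  then have "u \<in> dbm_set n (\<lambda>i j. Some (d (i, j))) prec"
    by (subst dbm_set_cong_on_unit_box[OF zu(2), where d = "\<lambda>i j. c (i, j) - z i + z j"])
      (simp_all add: d)
  ultimately have "r \<in> ?T d" using zu(2,3) by (auto intro: set_plus_intro)
  with \<open>d \<in> ?S\<close> show "r \<in> (\<Union>d\<in>?S. ?T d)" by blast
next
  fix r assume "r \<in> (\<Union>d\<in>?S. ?T d)"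
  then obtain d z u where d: "d \<in> ?S" and z: "z \<in> sign_cell n \<phi> d" and u: "u \<in> unit_box n"
    "u \<in> dbm_set n (\<lambda>i j. Some (d (i, j))) prec" and r: "r = real_vec z + u"
    by (auto elim!: set_plus_elim)
  from z obtain c where c: "sat c \<phi>" and zv: "z \<in> vecs n UNIV"
    and cd: "\<And>i j. i \<le> n \<Longrightarrow> j \<le> n \<Longrightarrow> sgn (c (i, j) - z i + z j) = d (i, j)"
    by (auto simp: sign_cell_def)
  \<comment> \<open>The entries of \<open>d\<close> are signs already, so taking the sign again
    changes nothing.\<close>
  have sgn_d: "sgn (c (i, j) - z i + z j) = sgn (d (i, j))" if "i \<le> n" "j \<le> n" for i j
    using cd[OF that] by (metis sgn_sgn)
  have "u \<in> dbm_set n (\<lambda>i j. Some (c (i, j) - z i + z j)) prec"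
    using dbm_set_cong_on_unit_box[OF u(1), where c = "\<lambda>i j. c (i, j) - z i + z j"
        and d = "\<lambda>i j. d (i, j)"] u(2) sgn_d by blast
  then have "r \<in> dbm_set n (\<lambda>i j. Some (c (i, j))) prec"
    using real_vec_add_in_dbm_set[OF zv] r by blast
  then show "r \<in> cp_dbm_set n \<phi> prec" using c unfolding cp_dbm_set_def by blast
qed

lemma CP_DBM_subset: "CP_DBM n \<subseteq> finite_unions (sum_sets n (FO_sets n) (Union_DBM_unit n))"
proof
  fix R assume "R \<in> CP_DBM n"
  then obtain \<phi> prec where R: "R = cp_dbm_set n \<phi> prec" unfolding CP_DBM_def by blast
  have "dbm_set n c prec \<inter> unit_box n \<in> Union_DBM_unit n" for c
    unfolding Union_DBM_unit_def
    by (auto intro!: finite_unions_singleton DBM_Int unit_box_in_DBM) (auto simp: DBM_def)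
  moreover have "sign_cell n \<phi> d \<subseteq> vecs n UNIV" for d by (auto simp: sign_cell_def)
  ultimately have "real_vec ` sign_cell n \<phi> d + (dbm_set n c prec \<inter> unit_box n)
      \<in> sum_sets n (FO_sets n) (Union_DBM_unit n)" for c d
    using sign_cell_in_FO_sets unfolding sum_sets_def by blast
  then show "R \<in> finite_unions (sum_sets n (FO_sets n) (Union_DBM_unit n))"
    unfolding R cp_dbm_set_eq_UN_sign_cells
    by (intro finite_unions_UN finite_PiE) auto
qed

section \<open>From sums back to CP-DBMs\<close>

lemma FO_plus_DBM_in_CP_DBM:
  assumes Z: "Z \<in> FO_sets n" and A: "A \<in> DBM n" "A \<subseteq> unit_box n"
  shows "real_vec ` Z + A \<in> CP_DBM n"
proof -
  obtain \<phi> where \<phi>: "free_vars \<phi> \<subseteq> {1..n}" "Z = {z \<in> vecs n UNIV. sat z \<phi>}"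
    using Z unfolding FO_sets_def by blast
  obtain k prec where A: "A = dbm_set n (\<lambda>i j. Some (k (i, j))) prec"
    by (rule DBM_bounded_entries[OF A])
  \<comment> \<open>The coordinate \<open>z\<^sub>i\<close> is stored in the extra column
    \<open>n + 1\<close>, which no parameter of dimension \<open>n\<close> occupies.\<close>
  define g where "g i = (i, n + 1)" for i :: nat
  have g: "inj g" by (auto simp: g_def inj_def)
  have inf: "infinite (UNIV :: (nat \<times> nat) set)" by (simp add: finite_prod)
  define P where "P w \<longleftrightarrow> sat (w \<circ> g) \<phi> \<and>
    term_val w (Plus (Var (g 0)) (Var (g 0))) = term_val w (Var (g 0)) \<and>
    (\<forall>p\<in>{0..n} \<times> {0..n}. term_val w (Plus (Var p) (Var (g (snd p)))) =
       term_val w (Var (g (fst p))) + k p)" for w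
  have P_iff: "P w \<longleftrightarrow> sat (w \<circ> g) \<phi> \<and> w (g 0) = 0 \<and>
      (\<forall>i\<le>n. \<forall>j\<le>n. w (i, j) - w (g i) + w (g j) = k (i, j))" for w
    unfolding P_def by (simp add: Ball_def algebra_simps imp_conjL)
  have "definable P"
    unfolding P_def
    by (intro definable_conj definable_sat g definable_eq definable_ball definable_eq_offset inf) simp
  then obtain \<psi> where \<psi>: "free_vars \<psi> \<subseteq> {0..n} \<times> {0..n}"
    "\<And>c. sat c \<psi> \<longleftrightarrow> (\<exists>w. (\<forall>x\<in>{0..n} \<times> {0..n}. w x = c x) \<and> P w)"
    by (rule definable_projection[where V = "{0..n} \<times> {0..n}"]) blast
  \<comment> \<open>The formula \<open>\<psi>\<close> thus describes exactly the bounds obtained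
    from \<open>k\<close> by translation along some member of \<open>Z\<close>.\<close>
  have sat_\<psi>: "sat c \<psi> \<longleftrightarrow> (\<exists>z\<in>Z. \<forall>i\<le>n. \<forall>j\<le>n. c (i, j) - z i + z j = k (i, j))" for c
  proof
    assume "sat c \<psi>"
    then obtain w where wc: "\<forall>x\<in>{0..n} \<times> {0..n}. w x = c x" and "P w"
      unfolding \<psi>(2) by blast
    then have w: "\<And>i j. i \<le> n \<Longrightarrow> j \<le> n \<Longrightarrow> w (i, j) = c (i, j)" "P w" by auto
    \<comment> \<open>Outside \<open>{1..n}\<close> the values of \<open>w \<circ> g\<close> need
      not vanish. Setting them to 0 yields a vector and does not affect \<open>\<phi>\<close>, whose
      free variables lie in \<open>{1..n}\<close>.\<close>
    define z where "z i = (if i \<in> {1..n} then w (g i) else 0)" for i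
    have zw: "z i = w (g i)" if "i \<le> n" for i
      using w(2) that by (cases "i = 0") (auto simp: z_def P_iff)
    have "sat z \<phi> \<longleftrightarrow> sat (w \<circ> g) \<phi>" using \<phi>(1) by (intro sat_cong) (auto simp: zw)
    then have "z \<in> Z" using w(2) by (auto simp: \<phi>(2) P_iff z_def vecs_def)
    moreover have "c (i, j) - z i + z j = k (i, j)" if "i \<le> n" "j \<le> n" for i j
      using w that by (auto simp: P_iff zw)
    ultimately show "\<exists>z\<in>Z. \<forall>i\<le>n. \<forall>j\<le>n. c (i, j) - z i + z j = k (i, j)" by blast
  next
    assume "\<exists>z\<in>Z. \<forall>i\<le>n. \<forall>j\<le>n. c (i, j) - z i + z j = k (i, j)"
    then obtain z where z: "z \<in> Z"
      and zc: "\<And>i j. i \<le> n \<Longrightarrow> j \<le> n \<Longrightarrow> c (i, j) - z i + z j = k (i, j)" by blast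
    define w where "w = (\<lambda>(i, j). if j = n + 1 then z i else c (i, j))"
    have "w \<circ> g = z" by (auto simp: w_def g_def)
    moreover have "z 0 = 0" "sat z \<phi>" using z by (auto simp: \<phi>(2) vecs_def)
    ultimately have "P w" unfolding P_iff using zc by (auto simp: w_def g_def)
    then show "sat c \<psi>" unfolding \<psi>(2) by (intro exI[of _ w]) (auto simp: w_def)
  qed
  have Z_vecs: "z \<in> vecs n UNIV" if "z \<in> Z" for z using that \<phi>(2) by blast
  have "real_vec ` Z + A = cp_dbm_set n \<psi> prec"
  proof (intro equalityI subsetI)
    fix r assume "r \<in> real_vec ` Z + A"
    then obtain z u where z: "z \<in> Z" and u: "u \<in> A" and r: "r = real_vec z + u"
      by (auto elim!: set_plus_elim)
    define c where "c = (\<lambda>(i, j). k (i, j) + z i - z j)"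
    have "r \<in> dbm_set n (\<lambda>i j. Some (c (i, j))) prec"
      unfolding r real_vec_add_in_dbm_set[OF Z_vecs[OF z]] using u by (simp add: A c_def)
    moreover have "sat c \<psi>" unfolding sat_\<psi> by (intro bexI[OF _ z]) (simp add: c_def)
    ultimately show "r \<in> cp_dbm_set n \<psi> prec" unfolding cp_dbm_set_def by blast
  next
    fix r assume "r \<in> cp_dbm_set n \<psi> prec"
    then obtain c where "sat c \<psi>" and r: "r \<in> dbm_set n (\<lambda>i j. Some (c (i, j))) prec"
      unfolding cp_dbm_set_def by blast
    then obtain z where z: "z \<in> Z"
      and zc: "\<And>i j. i \<le> n \<Longrightarrow> j \<le> n \<Longrightarrow> c (i, j) - z i + z j = k (i, j)"
      using sat_\<psi> by blast
    define u where "u = r - real_vec z"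
    have r_eq: "r = real_vec z + u" by (simp add: u_def fun_eq_iff)
    have "u \<in> dbm_set n (\<lambda>i j. Some (c (i, j) - z i + z j)) prec"
      using r unfolding r_eq real_vec_add_in_dbm_set[OF Z_vecs[OF z]] .
    then have "u \<in> A" by (simp add: A dbm_set_def zc del: of_int_add of_int_diff)
    then show "r \<in> real_vec ` Z + A" unfolding r_eq by (intro set_plus_intro imageI z)
  qed
  then show ?thesis using \<psi>(1) unfolding CP_DBM_def by blast
qed

text \<open>Addition of sets distributes over unions, so it suffices to treat the DBMs making up
  \<open>D\<close> one at a time.\<close>

lemma sum_sets_subset: "sum_sets n (FO_sets n) (Union_DBM_unit n) \<subseteq> finite_unions (CP_DBM n)"
proof
  fix R assume "R \<in> sum_sets n (FO_sets n) (Union_DBM_unit n)"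
  then obtain Z F where ZF: "Z \<in> FO_sets n" "finite F" "F \<subseteq> DBM n" "\<Union>F \<subseteq> unit_box n"
    and R: "R = real_vec ` Z + \<Union>F"
    unfolding sum_sets_def Union_DBM_unit_def finite_unions_def by blast
  have "R = (\<Union>A\<in>F. real_vec ` Z + A)" unfolding R set_plus_def by blast
  moreover have "real_vec ` Z + A \<in> CP_DBM n" if "A \<in> F" for A
    using that ZF by (intro FO_plus_DBM_in_CP_DBM) auto
  ultimately show "R \<in> finite_unions (CP_DBM n)"
    using ZF(2) by (simp add: finite_unions_UN)
qed

theorem proposition8:
  fixes n :: nat
  shows "Union_CP_DBM n = compose_classes n (FO_sets n) (Union_DBM_unit n)"
  unfolding Union_CP_DBM_def compose_classes_eq_finite_unions[OF empty_in_sum_sets]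
  using finite_unions_subset[OF CP_DBM_subset] finite_unions_subset[OF sum_sets_subset]
  by (rule equalityI)

end
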